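(* Consider ski rental with known varying prices $p$ and a self-prediction $\widehat T\ge1$ of the unknown active time $T\ge1$. Let $A$ be the algorithm that blindly follows the predictor: if $\widehat T\ge\min\{P_i:i\le\widehat T\}$, then buy on any day $i_1\le\widehat T$ such that $P_{i_1}=\min\{P_i:i\le\widehat T\}$; otherwise keep renting. Then $A$ is simple and $1$-consistent, but it is $r$-robust for no $r>0$.
   Context: Fix an integer $B\ge2$. A price sequence $p=(p_i)_{i\ge1}$ consists of integers $0\le p_i\le B$ and is truncated at the first $i$ with $p_i=0$; so $p$ is either infinite with all entries $\ge1$, or finite, $p=(p_1,\dots,p_n)$ with $p_n=0$ (a free day) and $p_i\ge1$ for $i<n$. All quantities range only over indices for which $p_i$ is defined. Put $P_i=i-1+p_i$ (total cost of renting on days $1,\dots,i-1$ and buying on day $i$) and $M_*(p)=\min\{P_i:i\ge1\}$. The agent knows $p$, is active for $T\ge1$ days ($T$ unknown), and has an integer prediction $\widehat T\ge1$ of $T$. Renting costs $1$ per day. If the algorithm decides to buy on day $i_1$, its cost is $T$ if $T<i_1$ and $P_{i_1}$ if $T\ge i_1$. If it decides to keep renting, it pays $1$ for each active day preceding the free day (if any), after which the resource is free: the cost is $T$ if $p$ is infinite and $\min(T,n-1)$ if $p=(p_1,\dots,p_n)$ with $p_n=0$. The offline optimum is $OPT_T(p)=\min\bigl(\{T\}\cup\{P_i:1\le i\le T\}\bigr)$. Simple: let $f(k,\widehat T,p)$ be the amount the algorithm offers toward buying on day $k$ (equal to $p_{i_1}$ if $k=i_1$ is its buying day, and $0$ on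 all other days). The algorithm is simple if $f(k,\widehat T_1,p)=f(k,\widehat T_2,p)$ whenever $\widehat T_1,\widehat T_2<M_*(p)$ or $\widehat T_1,\widehat T_2\ge M_*(p)$; in other words, all that matters about the prediction is whether $\widehat T\ge M_*(p)$. $\beta$-consistent: for all $p$ and $T$, when $\widehat T=T$ the cost is at most $\beta\cdot OPT_T(p)$. $\gamma$-robust: there is a constant $d$ (which may depend on $\gamma$, but not on $p,T,\widehat T$) such that for all $p,T,\widehat T$ the cost is at most $\gamma\cdot OPT_T(p)+d$.
   Formalization: Simplicity is stated only when, for each p, the buying day i_1 does not vary with the prediction; otherwise it fails: for p = 2,1,1,... days 1 and 2 tie, and predictions 2 and 3 could pick different days. The consistency and robustness claims cover all tie-breaking. *)

theory Defs
  imports Complex_Main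
begin

text \<open>
  Days are numbered from 1. A price sequence is a total function that is 0 at the dummy index 0
  and stays 0 after the first free day. So finite and infinite sequences each have exactly one
  representation, and an algorithm that reads \<open>p\<close> sees nothing beyond the truncation.
\<close>

definition price_seq :: "nat \<Rightarrow> (nat \<Rightarrow> nat) \<Rightarrow> bool" where
  "price_seq B p \<longleftrightarrow>
     p 0 = 0 \<and> (\<forall>i. p i \<le> B) \<and> (\<forall>i\<ge>1. p i = 0 \<longrightarrow> p (Suc i) = 0)"

text \<open>The indices at which the truncated sequence is defined (the free day included).\<close>

definition days :: "(nat \<Rightarrow> nat) \<Rightarrow> nat set" where
  "days p = {i. 1 \<le> i \<and> (\<forall>j. 1 \<le> j \<and> j < i \<longrightarrow> p j \<noteq> 0)}"

definition total_cost :: "(nat \<Rightarrow> nat) \<Rightarrow> nat \<Rightarrow> nat" where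
  "total_cost p i = i - 1 + p i"

definition M_star :: "(nat \<Rightarrow> nat) \<Rightarrow> nat" where
  "M_star p = Inf (total_cost p ` days p)"

text \<open>The minimum of \<open>P\<^sub>i\<close> over \<open>i \<le> t\<close>; only used for \<open>t \<ge> 1\<close>, where the set is nonempty.\<close>

definition min_upto :: "(nat \<Rightarrow> nat) \<Rightarrow> nat \<Rightarrow> nat" where
  "min_upto p t = Min (total_cost p ` {i \<in> days p. i \<le> t})"

definition OPT :: "nat \<Rightarrow> (nat \<Rightarrow> nat) \<Rightarrow> nat" where
  "OPT T p = Min ({T} \<union> total_cost p ` {i \<in> days p. i \<le> T})"

definition rent_cost :: "nat \<Rightarrow> (nat \<Rightarrow> nat) \<Rightarrow> nat" where
  "rent_cost T p =
     (if \<exists>n\<ge>1. p n = 0 then min T ((LEAST n. 1 \<le> n \<and> p n = 0) - 1) else T)"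

text \<open>
  An algorithm maps the prediction and the price sequence to a decision: \<open>Some i\<close> means buying on
  day \<open>i\<close>, \<open>None\<close> means to keep renting.
\<close>

type_synonym algorithm = "nat \<Rightarrow> (nat \<Rightarrow> nat) \<Rightarrow> nat option"

definition cost :: "nat option \<Rightarrow> nat \<Rightarrow> (nat \<Rightarrow> nat) \<Rightarrow> nat" where
  "cost dec T p =
     (case dec of
        Some i \<Rightarrow> (if T < i then T else total_cost p i)
      | None \<Rightarrow> rent_cost T p)"

definition offer :: "algorithm \<Rightarrow> nat \<Rightarrow> nat \<Rightarrow> (nat \<Rightarrow> nat) \<Rightarrow> nat" where
  "offer A k That p =
     (case A That p of Some i \<Rightarrow> (if k = i then p i else 0) | None \<Rightarrow> 0)"

definition simple :: "nat \<Rightarrow> algorithm \<Rightarrow> bool" where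
  "simple B A \<longleftrightarrow>
     (\<forall>p T1 T2. price_seq B p \<and> 1 \<le> T1 \<and> 1 \<le> T2 \<and>
        ((T1 < M_star p \<and> T2 < M_star p) \<or> (T1 \<ge> M_star p \<and> T2 \<ge> M_star p)) \<longrightarrow>
        (\<forall>k\<ge>1. offer A k T1 p = offer A k T2 p))"

definition consistent :: "nat \<Rightarrow> real \<Rightarrow> algorithm \<Rightarrow> bool" where
  "consistent B \<beta> A \<longleftrightarrow>
     (\<forall>p T. price_seq B p \<and> 1 \<le> T \<longrightarrow>
        real (cost (A T p) T p) \<le> \<beta> * real (OPT T p))"

definition robust :: "nat \<Rightarrow> real \<Rightarrow> algorithm \<Rightarrow> bool" where
  "robust B \<gamma> A \<longleftrightarrow>
     (\<exists>d::real. \<forall>p T That. price_seq B p \<and> 1 \<le> T \<and> 1 \<le> That \<longrightarrow>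
        real (cost (A That p) T p) \<le> \<gamma> * real (OPT T p) + d)"

text \<open>The algorithms that blindly follow the predictor, with arbitrary tie-breaking.\<close>

definition blindly_follows :: "nat \<Rightarrow> algorithm \<Rightarrow> bool" where
  "blindly_follows B A \<longleftrightarrow>
     (\<forall>p That. price_seq B p \<and> 1 \<le> That \<longrightarrow>
        (if That \<ge> min_upto p That
         then \<exists>i\<^sub>1\<in>days p. i\<^sub>1 \<le> That \<and> total_cost p i\<^sub>1 = min_upto p That \<and> A That p = Some i\<^sub>1
         else A That p = None))"

text \<open>
  Ties are broken independently of the prediction: for each \<open>p\<close> there is one fixed day on which
  the algorithm buys whenever it buys at all. Without this, simplicity fails: for prices
  \<open>2, 1, 1, \<dots>\<close> days 1 and 2 tie, and the prediction could select between them.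
\<close>

definition fixed_tie_breaking :: "nat \<Rightarrow> algorithm \<Rightarrow> bool" where
  "fixed_tie_breaking B A \<longleftrightarrow>
     (\<forall>p. price_seq B p \<longrightarrow>
        (\<exists>i\<^sub>1. \<forall>That\<ge>1. A That p = None \<or> A That p = Some i\<^sub>1))"

text \<open>Such algorithms exist: buy on the earliest minimizing day.\<close>

lemma min_upto_attained:
  assumes "1 \<le> t"
  shows "\<exists>i\<in>days p. i \<le> t \<and> total_cost p i = min_upto p t"
proof -
  let ?S = "{i \<in> days p. i \<le> t}"
  have "1 \<in> ?S" using assms by (auto simp: days_def)
  then have "min_upto p t \<in> total_cost p ` ?S"
    unfolding min_upto_def by (intro Min_in) auto
  then show ?thesis by auto
qed

lemma min_upto_le:
  assumes "i \<in> days p" "i \<le> t"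
  shows "min_upto p t \<le> total_cost p i"
  unfolding min_upto_def using assms by (intro Min_le) auto

lemma min_upto_eq:
  assumes "1 \<le> s" "s \<le> t" "min_upto p s \<le> s"
  shows "min_upto p t = min_upto p s"
proof -
  obtain i where i: "i \<in> days p" "i \<le> t" "total_cost p i = min_upto p t"
    using min_upto_attained[of t p] assms by auto
  obtain j where j: "j \<in> days p" "j \<le> s" "total_cost p j = min_upto p s"
    using min_upto_attained[of s p] assms by auto
  have le: "min_upto p t \<le> min_upto p s"
    using min_upto_le[of j p t] j assms by auto
  have "min_upto p s \<le> min_upto p t"
  proof (cases "i \<le> s")
    case True
    then show ?thesis using min_upto_le[of i p s] i by auto
  next
    case False
    then have "s \<le> total_cost p i" by (simp add: total_cost_def)
    then show ?thesis using i assms by simp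
  qed
  with le show ?thesis by simp
qed

lemma blindly_follows_fixed_tie_breaking_exists:
  "\<exists>A. blindly_follows B A \<and> fixed_tie_breaking B A"
proof -
  define L where "L m p = (LEAST i. i \<in> days p \<and> total_cost p i = m)" for m p
  define A :: algorithm where
    "A t p = (if min_upto p t \<le> t then Some (L (min_upto p t) p) else None)" for t p
  have "L (min_upto p t) p \<in> days p \<and> L (min_upto p t) p \<le> t \<and>
        total_cost p (L (min_upto p t) p) = min_upto p t" if t: "1 \<le> t" for t p
  proof -
    obtain i where i: "i \<in> days p \<and> total_cost p i = min_upto p t" "i \<le> t"
      using min_upto_attained[OF t, of p] by auto
    let ?Q = "\<lambda>i. i \<in> days p \<and> total_cost p i = min_upto p t"
    have "?Q (Least ?Q)" by (rule LeastI[of ?Q, OF i(1)])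
    moreover have "Least ?Q \<le> t"
      using Least_le[of ?Q, OF i(1)] i(2) by (rule order_trans)
    ultimately show ?thesis unfolding L_def by blast
  qed
  then have "blindly_follows B A"
    unfolding blindly_follows_def A_def by (metis (no_types, lifting))
  moreover have "fixed_tie_breaking B A"
    unfolding fixed_tie_breaking_def
  proof (intro allI impI)
    fix p
    have eq: "min_upto p s = min_upto p t"
      if "1 \<le> s" "1 \<le> t" "min_upto p s \<le> s" "min_upto p t \<le> t" for s t
      using min_upto_eq[of s t p] min_upto_eq[of t s p] that by (cases "s \<le> t") auto
    show "\<exists>i\<^sub>1. \<forall>That\<ge>1. A That p = None \<or> A That p = Some i\<^sub>1"
    proof (cases "\<exists>s\<ge>1. min_upto p s \<le> s")
      case True
      then obtain s where "1 \<le> s" "min_upto p s \<le> s" by auto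
      then have "\<forall>t\<ge>1. A t p = None \<or> A t p = Some (L (min_upto p s) p)"
        unfolding A_def using eq[of s] by (metis (no_types, lifting))
      then show ?thesis by blast
    next
      case False
      then show ?thesis by (auto simp: A_def)
    qed
  qed
  ultimately show ?thesis by blast
qed

end

theory Submission
  imports Defs
begin

text \<open>
  A day \<open>i\<close> with \<open>P\<^sub>i = M\<^sub>*\<close> is visible to every prediction \<open>t \<ge> M\<^sub>*\<close>, except when \<open>t = i - 1\<close> and
  day \<open>i\<close> is free. In that case the algorithm rents for \<open>t\<close> but buys on the free day for larger
  predictions, and both decisions offer \<open>0\<close> every day, so simplicity survives.
  Consistency holds because for a correct prediction the algorithm pays
  \<open>min T (min_upto p T)\<close>, which is the optimum. Against the constant price \<open>B\<close>, the prediction \<open>1\<close>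
  makes the algorithm rent forever, while the optimum stays at most \<open>B\<close>.
\<close>

lemma M_star_le: "i \<in> days p \<Longrightarrow> M_star p \<le> total_cost p i"
  unfolding M_star_def by (simp add: cInf_lower)

lemma M_star_attained: "\<exists>i\<in>days p. total_cost p i = M_star p"
proof -
  have "1 \<in> days p" by (simp add: days_def)
  then have "Inf (total_cost p ` days p) \<in> total_cost p ` days p"
    by (intro Inf_nat_def1) auto
  then show ?thesis unfolding M_star_def by auto
qed

lemma M_star_le_min_upto: "1 \<le> t \<Longrightarrow> M_star p \<le> min_upto p t"
  by (metis M_star_le min_upto_attained)

text \<open>A day \<open>i > t\<close> has \<open>total_cost p i \<ge> i - 1 \<ge> t\<close>, so it
  cannot undercut a minimum that is at most \<open>t\<close>. The horizon \<open>max t i\<close> in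
  the proof takes in a day attaining \<open>M_star p\<close>.\<close>

lemma min_upto_eq_M_star:
  assumes t: "1 \<le> t" and le: "min_upto p t \<le> t"
  shows "min_upto p t = M_star p"
proof -
  obtain i where "i \<in> days p" "total_cost p i = M_star p"
    using M_star_attained by blast
  moreover have "min_upto p (max t i) = min_upto p t"
    using t le by (intro min_upto_eq) auto
  ultimately have "min_upto p t \<le> M_star p"
    using min_upto_le[of i p "max t i"] by simp
  then show ?thesis using M_star_le_min_upto[OF t, of p] by simp
qed

lemma OPT_eq_min:
  assumes "1 \<le> T"
  shows "OPT T p = min T (min_upto p T)"
proof -
  have "{i \<in> days p. i \<le> T} \<noteq> {}" using min_upto_attained[OF assms, of p] by blast
  then show ?thesis unfolding OPT_def min_upto_def by simp
qed

lemma rent_cost_le: "rent_cost T p \<le> T"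
  by (simp add: rent_cost_def)

lemma blindly_follows_NoneD:
  assumes "blindly_follows B A" "price_seq B p" "1 \<le> t" "A t p = None"
  shows "t < min_upto p t"
  using assms unfolding blindly_follows_def by (metis not_le option.distinct(1))

lemma blindly_follows_SomeD:
  assumes "blindly_follows B A" "price_seq B p" "1 \<le> t" "A t p = Some i"
  shows "i \<in> days p" "i \<le> t" "total_cost p i = min_upto p t" "min_upto p t \<le> t"
  using assms unfolding blindly_follows_def
  by (metis option.distinct(1) option.inject)+

text \<open>If \<open>p i\<close> were positive, then
  \<open>i \<le> total_cost p i = M_star p \<le> s\<close>: day \<open>i\<close> would lie within
  the horizon \<open>s\<close> at cost at most \<open>s\<close>, and prediction \<open>s\<close>
  would buy.\<close>

lemma None_Some_imp_free:
  assumes A: "blindly_follows B A" and p: "price_seq B p"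
    and s: "1 \<le> s" "M_star p \<le> s" "A s p = None"
    and t: "1 \<le> t" "A t p = Some i"
  shows "p i = 0"
proof (rule ccontr)
  note S = blindly_follows_SomeD[OF A p t]
  assume "p i \<noteq> 0"
  moreover have "total_cost p i = M_star p"
    using S min_upto_eq_M_star[OF t(1)] by simp
  ultimately have "i \<le> s" "total_cost p i \<le> s"
    using s(2) by (auto simp: total_cost_def)
  then show False
    using min_upto_le[OF S(1)] blindly_follows_NoneD[OF A p s(1,3)] by fastforce
qed

lemma blindly_follows_simple:
  assumes A: "blindly_follows B A" and fixed: "fixed_tie_breaking B A"
  shows "simple B A"
  unfolding simple_def
proof (intro allI impI)
  fix p s t k
  assume *: "price_seq B p \<and> 1 \<le> s \<and> 1 \<le> t \<and>
    ((s < M_star p \<and> t < M_star p) \<or> (s \<ge> M_star p \<and> t \<ge> M_star p))"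
  then have p: "price_seq B p" and s: "1 \<le> s" and t: "1 \<le> t" by auto
  \<comment> \<open>Buying requires \<open>min_upto p u \<le> u\<close>, but \<open>M_star p\<close>
    bounds \<open>min_upto p u\<close> from below.\<close>
  have None_if: "A u p = None" if "1 \<le> u" "u < M_star p" for u
    using blindly_follows_SomeD(4)[OF A p that(1)] M_star_le_min_upto[OF that(1), of p] that(2)
    by (cases "A u p") fastforce+
  obtain i where i: "A s p = None \<or> A s p = Some i" "A t p = None \<or> A t p = Some i"
    using fixed p s t unfolding fixed_tie_breaking_def by blast
  show "offer A k s p = offer A k t p"
  proof (cases "s < M_star p")
    case True
    then show ?thesis using * None_if by (simp add: offer_def)
  next
    case False
    then have M: "M_star p \<le> s" "M_star p \<le> t" using * by auto
    show ?thesis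
      using i None_Some_imp_free[OF A p s M(1) _ t]
        None_Some_imp_free[OF A p t M(2) _ s]
      by (auto simp: offer_def split: option.splits)
  qed
qed

lemma blindly_follows_consistent:
  assumes A: "blindly_follows B A"
  shows "consistent B 1 A"
  unfolding consistent_def
proof (intro allI impI)
  fix p and T :: nat
  assume "price_seq B p \<and> 1 \<le> T"
  then have p: "price_seq B p" and T: "1 \<le> T" by auto
  have "cost (A T p) T p \<le> OPT T p"
  proof (cases "A T p")
    case None
    \<comment> \<open>Here \<open>T < min_upto p T\<close>, so the optimum is \<open>T\<close>, and
      renting never exceeds \<open>T\<close>.\<close>
    then show ?thesis
      using blindly_follows_NoneD[OF A p T] rent_cost_le[of T p]
      by (simp add: cost_def OPT_eq_min[OF T])
  next
    case (Some i)
    then show ?thesis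
      using blindly_follows_SomeD[OF A p T Some]
      by (simp add: cost_def OPT_eq_min[OF T])
  qed
  then show "real (cost (A T p) T p) \<le> 1 * real (OPT T p)" by simp
qed

lemma blindly_follows_not_robust:
  assumes B: "B \<ge> 2" and A: "blindly_follows B A" and r: "r > 0"
  shows "\<not> robust B r A"
proof
  assume "robust B r A"
  then obtain d where d: "\<And>p T That. price_seq B p \<Longrightarrow> 1 \<le> T \<Longrightarrow> 1 \<le> That \<Longrightarrow>
      real (cost (A That p) T p) \<le> r * real (OPT T p) + d"
    unfolding robust_def by blast
  define p :: "nat \<Rightarrow> nat" where "p i = (if i = 0 then 0 else B)" for i
  have p: "price_seq B p" using B by (auto simp: price_seq_def p_def)
  \<comment> \<open>Prediction \<open>1\<close> sees only day 1, whose price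
    \<open>B \<ge> 2\<close> exceeds it.\<close>
  have "min_upto p 1 \<ge> B"
    using min_upto_attained[of 1 p] by (auto simp: days_def total_cost_def p_def)
  then have None: "A 1 p = None"
    using B blindly_follows_SomeD(4)[OF A p, of 1] by (cases "A 1 p") force+
  \<comment> \<open>Buying on day 1 keeps the optimum at most \<open>B\<close>, so robustness would
    cap the cost by \<open>r * B + d\<close> for every \<open>T\<close>.\<close>
  obtain T :: nat where "max 1 (r * B + d) < real T" using reals_Archimedean2 by blast
  then have T: "1 \<le> T" "r * B + d < real T" by auto
  have "min_upto p T \<le> total_cost p 1"
    using T(1) by (intro min_upto_le) (auto simp: days_def)
  then have "OPT T p \<le> B"
    by (simp add: OPT_eq_min[OF T(1)] total_cost_def p_def)
  then have "r * real (OPT T p) \<le> r * B" using r by simp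
  \<comment> \<open>No price from day 1 on is \<open>0\<close>, so renting is charged on all
    \<open>T\<close> days.\<close>
  moreover have "cost (A 1 p) T p = T"
    using B None by (simp add: cost_def rent_cost_def p_def)
  ultimately show False using d[OF p T(1), of 1] T(2) by simp
qed

theorem theorem4:
  fixes B :: nat and A :: algorithm
  assumes "B \<ge> 2" and "blindly_follows B A"
  shows "(fixed_tie_breaking B A \<longrightarrow> simple B A)
    \<and> consistent B 1 A
    \<and> (\<forall>r::real. r > 0 \<longrightarrow> \<not> robust B r A)"
  using assms blindly_follows_simple blindly_follows_consistent blindly_follows_not_robust
  by blast

end
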